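(* Let $\lambda>1$. For interval selection with proportional weights and revocable acceptances, Algorithm Revoke-Proportional with parameter $\lambda$ is $\frac{3\lambda}{\lambda-1}$-consistent; that is, for every instance and arrival order, whenever all predictions are accurate (with respect to a fixed optimal solution), $\frac{OPT}{ALG}\le \frac{3\lambda}{\lambda-1}$.
   Context: Interval selection: an instance is a finite nonempty set of intervals $[s_i,f_i)$ on the real line, $s_i<f_i$, arriving one at a time in an arbitrary (adversarial) order. Two intervals conflict if they intersect. Proportional weights means $w([s,f))=f-s$. The goal is to output a set of pairwise disjoint intervals of maximum total weight. $OPT$ denotes the maximum total weight of a set of pairwise disjoint intervals of the instance, and $ALG$ the total weight of the algorithm's final solution. Revocable acceptances: a newly arrived interval may be accepted by discarding all conflicting intervals in the current solution; rejected or discarded intervals can never be used again. Predictions: each interval $I$ arrives together with a bit $Prd(I)\in\{0,1\}$ predicting whether $I$ belongs to a fixed optimal solution $O$; all predictions are accurate if for every $I$, $Prd(I)=1\iff I\in O$. An algorithm is (strictly) $c$-competitive if $OPT/ALG\le c$ for all instances and arrival orders; it is $\gamma$-consistent if it is $\gamma$-competitive whenever all predictions are accurate. Algorithm Revoke-Proportional (parameter $\lambda>1$): start with an empty solution. On the arrival of $I$, let $I_s$ be the set of intervals currently in the solution conflicting with $I$, and $w_c=\sum_{J\in I_s}w(J)$. (1) Main rule: if $w(I)\ge\lambda\cdot w_c$, accept $I$ and discard all intervals of $I_s$. (2) Predictions rule: otherwise, if $Prd(I)=1$, $w(I)\ge w_c$, and no $J\in I_s$ has $Prd(J)=1$, accept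 $I$ and discard all intervals of $I_s$. (3) Otherwise reject $I$. *)

theory Defs
  imports Complex_Main
begin

text \<open>A pair \<open>(s, f)\<close> stands for the half-open interval \<open>[s, f)\<close>.\<close>

type_synonym interval = "real \<times> real"

definition ivl :: "interval \<Rightarrow> real set" where
  "ivl I = {fst I ..< snd I}"

definition conflict :: "interval \<Rightarrow> interval \<Rightarrow> bool" where
  "conflict I J \<longleftrightarrow> ivl I \<inter> ivl J \<noteq> {}"

definition weight :: "interval \<Rightarrow> real" where
  "weight I = snd I - fst I"

definition total_weight :: "interval set \<Rightarrow> real" where
  "total_weight T = (\<Sum>I\<in>T. weight I)"

text \<open>An instance is a set of intervals, so an instance together with its arrival order is a
  list without repetitions. In particular, predictions can be given as a function of the interval.\<close>

definition is_instance :: "interval list \<Rightarrow> bool" where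
  "is_instance xs \<longleftrightarrow> xs \<noteq> [] \<and> distinct xs \<and> (\<forall>I\<in>set xs. fst I < snd I)"

type_synonym prediction = "interval \<Rightarrow> bool"

definition feasible :: "interval set \<Rightarrow> interval set \<Rightarrow> bool" where
  "feasible S T \<longleftrightarrow> T \<subseteq> S \<and> pairwise (\<lambda>I J. \<not> conflict I J) T"

definition OPT :: "interval set \<Rightarrow> real" where
  "OPT S = Max (total_weight ` {T. feasible S T})"

definition optimal_solution :: "interval set \<Rightarrow> interval set \<Rightarrow> bool" where
  "optimal_solution S Q \<longleftrightarrow> feasible S Q \<and> total_weight Q = OPT S"

definition accurate :: "interval set \<Rightarrow> prediction \<Rightarrow> bool" where
  "accurate S prd \<longleftrightarrow> (\<exists>Q. optimal_solution S Q \<and> (\<forall>I\<in>S. prd I \<longleftrightarrow> I \<in> Q))"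

text \<open>An algorithm is represented by the map sending the predictions and the arrival order to the
  final solution.\<close>

type_synonym algorithm = "prediction \<Rightarrow> interval list \<Rightarrow> interval set"

definition ALG :: "algorithm \<Rightarrow> prediction \<Rightarrow> interval list \<Rightarrow> real" where
  "ALG A prd xs = total_weight (A prd xs)"

text \<open>Since \<open>x / 0 = 0\<close> in HOL, positivity of \<open>ALG\<close> is required explicitly: \<open>OPT\<close> is positive on
  every instance, so for \<open>ALG = 0\<close> the ratio is infinite.\<close>

definition competitive_at :: "real \<Rightarrow> algorithm \<Rightarrow> prediction \<Rightarrow> interval list \<Rightarrow> bool" where
  "competitive_at c A prd xs \<longleftrightarrow> 0 < ALG A prd xs \<and> OPT (set xs) / ALG A prd xs \<le> c"

definition consistent :: "real \<Rightarrow> algorithm \<Rightarrow> bool" where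
  "consistent \<gamma> A \<longleftrightarrow>
     (\<forall>prd xs. is_instance xs \<longrightarrow> accurate (set xs) prd \<longrightarrow> competitive_at \<gamma> A prd xs)"

definition conflicting :: "interval set \<Rightarrow> interval \<Rightarrow> interval set" where
  "conflicting Sol I = {J \<in> Sol. conflict I J}"

definition revoke_step :: "real \<Rightarrow> prediction \<Rightarrow> interval set \<Rightarrow> interval \<Rightarrow> interval set" where
  "revoke_step l prd Sol I =
     (let Is = conflicting Sol I; wc = total_weight Is in
      if weight I \<ge> l * wc then insert I (Sol - Is)
      else if prd I \<and> weight I \<ge> wc \<and> (\<forall>J\<in>Is. \<not> prd J) then insert I (Sol - Is)
      else Sol)"

definition revoke_proportional :: "real \<Rightarrow> algorithm" where
  "revoke_proportional l prd xs = foldl (revoke_step l prd) {} xs"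

end

theory Submission
  imports Defs
begin

text \<open>
  Let \<open>Q\<close> be the predicted optimal solution. A rejected interval \<open>I \<in> Q\<close> satisfies
  \<open>weight I < w\<^sub>c\<close> and conflicts only with solution intervals outside \<open>Q\<close>, so its weight can be
  distributed over these, each \<open>K\<close> receiving at most \<open>min (weight I) (weight K)\<close>. Since \<open>Q\<close> is
  conflict-free, such charges to \<open>K\<close> sum up to at most \<open>3 * weight K\<close>: the intervals of \<open>Q\<close>
  inside \<open>K\<close> contribute at most \<open>weight K\<close>, and so does each of the at most two sticking out
  of \<open>K\<close>.

  With \<open>h = 3 / (l - 1)\<close>, give a solution interval \<open>K \<notin> Q\<close> the potential \<open>h * weight K\<close> plus its
  charges so far, and \<open>K \<in> Q\<close> the potential \<open>(3 + h) * weight K\<close>. The total potential of the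
  solution always dominates the weight of the intervals of \<open>Q\<close> seen so far. For the main rule this
  is \<open>h * l = 3 + h\<close>; for the predictions rule accepting \<open>X\<close>, every discarded \<open>K\<close> still has an
  unused charge \<open>min (weight X) (weight K) = weight K\<close>, so its potential is at most
  \<open>(2 + h) * weight K\<close>, leaving room for \<open>weight X\<close> itself.
\<close>

section \<open>Disjoint intervals and the bound on charges\<close>

lemma conflict_iff:
  assumes "fst I < snd I" "fst J < snd J"
  shows "conflict I J \<longleftrightarrow> fst I < snd J \<and> fst J < snd I"
proof -
  have "max (fst I) (fst J) \<in> ivl I \<inter> ivl J" if "fst I < snd J" "fst J < snd I"
    using that assms by (auto simp: ivl_def)
  then show ?thesis
    by (auto simp: conflict_def ivl_def)
qed

text \<open>Induction by left endpoint: the rightmost interval \<open>x\<close> confines the others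
  to the stretch from \<open>a\<close> to \<open>fst x\<close>, so the lengths telescope.\<close>

lemma sum_weight_inside_le:
  assumes "finite F" "a \<le> b"
    and "\<And>I. I \<in> F \<Longrightarrow> fst I < snd I \<and> a \<le> fst I \<and> snd I \<le> b"
    and "pairwise (\<lambda>I J. \<not> conflict I J) F"
  shows "sum weight F \<le> b - a"
  using assms
proof (induction F arbitrary: b rule: finite_ranking_induct[where f = fst])
  case empty
  then show ?case by simp
next
  case (insert x S)
  have "snd y \<le> fst x" if "y \<in> S - {x}" for y
  proof -
    have "\<not> conflict x y"
      using that by (intro pairwiseD[OF insert.prems(3)]) auto
    then show ?thesis
      using that insert.prems(2)[of x] insert.prems(2)[of y] insert.hyps(2)[of y]
        conflict_iff[of x y] by auto
  qed
  then have "sum weight (S - {x}) \<le> fst x - a" if "x \<notin> S"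
    using that insert.prems by (simp, intro insert.IH) (auto simp: pairwise_insert)
  moreover have "sum weight S \<le> b - a" if "x \<in> S"
    using that insert.prems by (intro insert.IH) (auto simp: insert_absorb)
  ultimately show ?case
    using insert.hyps(1) insert.prems(2)[of x]
    by (cases "x \<in> S") (simp_all add: insert_absorb weight_def)
qed

lemma sum_le_if_card_le_1:
  fixes f :: "'a \<Rightarrow> real"
  assumes "\<And>x y. x \<in> A \<Longrightarrow> y \<in> A \<Longrightarrow> x = y" "\<And>x. x \<in> A \<Longrightarrow> f x \<le> c" "0 \<le> c"
  shows "sum f A \<le> c"
proof (cases "A = {}")
  case False
  then obtain x where "A = {x}"
    using assms(1) by blast
  then show ?thesis
    using assms(2) by simp
qed (use assms(3) in simp)

lemma sum_Un_le:
  fixes f :: "'a \<Rightarrow> real"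
  assumes "finite A" "finite B" "\<And>x. x \<in> A \<union> B \<Longrightarrow> 0 \<le> f x"
  shows "sum f (A \<union> B) \<le> sum f A + sum f B"
proof -
  have "0 \<le> sum f (A \<inter> B)"
    using assms(3) by (intro sum_nonneg) auto
  then show ?thesis
    using sum.union_inter[OF assms(1,2), of f] by linarith
qed

text \<open>Counts every conflicting interval of \<open>R\<close>, rejected or not, earlier or later
  than \<open>K\<close>. Charges thus need no record of the run.\<close>

definition charge :: "interval set \<Rightarrow> interval \<Rightarrow> real" where
  "charge R K = (\<Sum>I | I \<in> R \<and> conflict I K. min (weight I) (weight K))"

lemma charge_le:
  assumes "finite R" "fst K < snd K"
    and proper: "\<And>I. I \<in> R \<Longrightarrow> fst I < snd I"
    and disj: "pairwise (\<lambda>I J. \<not> conflict I J) R"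
  shows "charge R K \<le> 3 * weight K"
proof -
  define C where "C = {I \<in> R. conflict I K}"
  define A where "A = {I \<in> C. fst K \<le> fst I \<and> snd I \<le> snd K}"
  define L where "L = {I \<in> C. fst I < fst K}"
  define U where "U = {I \<in> C. snd K < snd I}"
  let ?f = "\<lambda>I. min (weight I) (weight K)"
  have fin: "finite A" "finite L" "finite U"
    using assms(1) by (auto simp: A_def L_def U_def C_def)
  have meets: "fst I < snd K \<and> fst K < snd I" if "I \<in> C" for I
    using that assms(2) proper[of I] conflict_iff[of I K] by (auto simp: C_def)
  have same: "I = J" if "I \<in> R" "J \<in> R" "fst I < snd J" "fst J < snd I" for I J
    using that proper disj conflict_iff[of I J] by (auto simp: pairwise_def)
  have nonneg: "0 \<le> ?f I" if "I \<in> R" for I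
    using proper[OF that] assms(2) by (simp add: weight_def)
  \<comment> \<open>Members of \<open>L\<close> share the point \<open>fst K\<close>, and members of
    \<open>U\<close> share \<open>snd K\<close>.\<close>
  have "I = J" if "I \<in> L" "J \<in> L" for I J
    using that meets[of I] meets[of J] by (intro same) (auto simp: L_def C_def)
  then have L: "sum ?f L \<le> weight K"
    using assms(2) by (intro sum_le_if_card_le_1) (auto simp: weight_def)
  have "I = J" if "I \<in> U" "J \<in> U" for I J
    using that meets[of I] meets[of J] by (intro same) (auto simp: U_def C_def)
  then have U: "sum ?f U \<le> weight K"
    using assms(2) by (intro sum_le_if_card_le_1) (auto simp: weight_def)
  have "sum ?f A \<le> sum weight A"
    by (intro sum_mono) simp
  also have "\<dots> \<le> snd K - fst K"
    using assms fin by (intro sum_weight_inside_le)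
      (auto simp: A_def C_def intro: pairwise_subset[OF disj])
  finally have A: "sum ?f A \<le> weight K"
    by (simp add: weight_def)
  \<comment> \<open>An interval sticking out of \<open>K\<close> on both sides lies in
    \<open>L\<close> and in \<open>U\<close>; counting it twice is harmless for an upper
    bound.\<close>
  have "C = A \<union> (L \<union> U)"
    by (auto simp: A_def L_def U_def)
  then have "charge R K = sum ?f (A \<union> (L \<union> U))"
    by (simp add: charge_def C_def)
  also have "\<dots> \<le> sum ?f A + sum ?f (L \<union> U)"
    using fin nonneg by (intro sum_Un_le) (auto simp: A_def L_def U_def C_def)
  also have "sum ?f (L \<union> U) \<le> sum ?f L + sum ?f U"
    using fin nonneg by (intro sum_Un_le) (auto simp: L_def U_def C_def)
  finally show ?thesis
    using A L U by linarith
qed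

lemma charge_insert:
  assumes "finite R" "X \<notin> R"
  shows "charge (insert X R) K =
    (if conflict X K then min (weight X) (weight K) else 0) + charge R K"
proof -
  have "{I. I \<in> insert X R \<and> conflict I K} =
      (if conflict X K then insert X {I. I \<in> R \<and> conflict I K} else {I. I \<in> R \<and> conflict I K})"
    by auto
  then show ?thesis
    using assms by (auto simp: charge_def)
qed

text \<open>Either one term alone reaches \<open>c\<close>, or no minimum truncates. This splits the
  weight of a rejected interval into charges.\<close>

lemma min_le_sum_min:
  fixes f :: "'a \<Rightarrow> real"
  assumes "finite A" "0 \<le> c" "\<And>x. x \<in> A \<Longrightarrow> 0 \<le> f x"
  shows "min c (sum f A) \<le> (\<Sum>x\<in>A. min c (f x))"
proof (cases "\<exists>x\<in>A. c \<le> f x")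
  case True
  then obtain x where "x \<in> A" "c \<le> f x" by blast
  then show ?thesis
    using member_le_sum[of x A "\<lambda>x. min c (f x)"] assms by auto
next
  case False
  then have "(\<Sum>x\<in>A. min c (f x)) = sum f A"
    by (intro sum.cong) auto
  then show ?thesis by simp
qed

section \<open>Potential and its behaviour at one arrival\<close>

definition potential :: "real \<Rightarrow> interval set \<Rightarrow> interval set \<Rightarrow> interval \<Rightarrow> real" where
  "potential h Q R K = (if K \<in> Q then (3 + h) * weight K else h * weight K + charge R K)"

lemma potential_le:
  assumes "finite R" "fst K < snd K" "\<And>I. I \<in> R \<Longrightarrow> fst I < snd I"
    and "pairwise (\<lambda>I J. \<not> conflict I J) R"
  shows "potential h Q R K \<le> (3 + h) * weight K"
  using charge_le[OF assms] by (auto simp: potential_def algebra_simps)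

text \<open>Meant for an acceptance: \<open>p\<close> and \<open>q\<close> are the potentials before
  and after, \<open>D\<close> is discarded, \<open>d\<close> is the new weight to cover. Survivors
  never lose, so comparing \<open>D\<close> with \<open>X\<close> suffices.\<close>

lemma sum_exchange_le:
  fixes p q :: "'a \<Rightarrow> real"
  assumes "finite S" "D \<subseteq> S" "X \<notin> S" "\<And>K. K \<in> S \<Longrightarrow> p K \<le> q K" "sum p D + d \<le> q X"
  shows "sum p S + d \<le> sum q (insert X (S - D))"
proof -
  have "sum p S = sum p (S - D) + sum p D"
    using assms(1,2) by (rule sum.subset_diff[rotated])
  moreover have "sum p (S - D) \<le> sum q (S - D)"
    using assms(4) by (intro sum_mono) auto
  moreover have "sum q (insert X (S - D)) = q X + sum q (S - D)"
    using assms(1,3) by simp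
  ultimately show ?thesis
    using assms(5) by linarith
qed

text \<open>Here \<open>R\<close> plays the part of \<open>Q\<close> that arrived before
  \<open>X\<close>, and \<open>S\<close> the current solution.\<close>

lemma revoke_step_potential:
  fixes l :: real and R S :: "interval set"
  defines "h \<equiv> 3 / (l - 1)"
  assumes l: "l > 1"
    and fin: "finite S" "finite R"
    and proper: "\<And>I. I \<in> insert X (R \<union> S) \<Longrightarrow> fst I < snd I"
    and X: "X \<notin> S" "X \<notin> R"
    and Q: "pairwise (\<lambda>I J. \<not> conflict I J) Q" "R \<subseteq> Q"
    and prd: "\<And>I. I \<in> insert X S \<Longrightarrow> prd I \<longleftrightarrow> I \<in> Q"
    and inv: "total_weight R \<le> sum (potential h Q R) S"
  defines "R' \<equiv> if X \<in> Q then insert X R else R"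
  shows "total_weight R' \<le> sum (potential h Q R') (revoke_step l prd S X)"
proof -
  define D where "D = conflicting S X"
  define d where "d = (if X \<in> Q then weight X else 0)"
  have h: "0 < h" "h * l = 3 + h"
    using l by (auto simp: h_def field_simps)
  have D: "D \<subseteq> S" "finite D" "\<And>K. K \<in> D \<Longrightarrow> conflict X K"
    using fin by (auto simp: D_def conflicting_def)
  have w: "0 < weight K" if "K \<in> insert X (R \<union> S)" for K
    using proper[OF that] by (simp add: weight_def)
  have wD: "sum weight D = total_weight D"
    by (simp add: total_weight_def)
  have finR': "finite R'"
    using fin by (simp add: R'_def)
  have dR': "pairwise (\<lambda>I J. \<not> conflict I J) R'"
    using Q by (auto simp: R'_def intro: pairwise_subset)
  have dR: "pairwise (\<lambda>I J. \<not> conflict I J) R"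
    using Q by (auto intro: pairwise_subset)
  have TR': "total_weight R' = total_weight R + d"
    using fin X by (simp add: R'_def d_def total_weight_def)
  have mono: "potential h Q R K \<le> potential h Q R' K" if "K \<in> S" for K
    using w[of K] w[of X] that fin X
    by (auto simp: potential_def R'_def charge_insert)
  have charge_nonneg: "0 \<le> charge R' X"
    using w unfolding charge_def by (intro sum_nonneg) (auto simp: R'_def less_imp_le split: if_splits)
  have accept: "total_weight R' \<le> sum (potential h Q R') (insert X (S - D))"
    if "sum (potential h Q R) D + d \<le> potential h Q R' X"
    using sum_exchange_le[OF fin(1) D(1) X(1) mono that] inv TR' by simp
  show ?thesis
  proof (cases "weight X \<ge> l * total_weight D")
    case True
    have "sum (potential h Q R) D \<le> (\<Sum>K\<in>D. (3 + h) * weight K)"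
      using D proper fin dR by (intro sum_mono potential_le) auto
    also have "\<dots> = (3 + h) * total_weight D"
      by (simp add: sum_distrib_left wD[symmetric])
    also have "\<dots> = h * (l * total_weight D)"
      using h(2) by (metis mult.assoc)
    also have "\<dots> \<le> h * weight X"
      using True h by simp
    finally have "sum (potential h Q R) D + d \<le> potential h Q R' X"
      using w[of X] charge_nonneg by (auto simp: potential_def d_def distrib_right)
    then show ?thesis
      using accept True by (simp add: revoke_step_def Let_def D_def)
  next
    case nmain: False
    show ?thesis
    proof (cases "X \<in> Q")
      case False
      then show ?thesis
        using nmain prd inv by (simp add: revoke_step_def Let_def D_def R'_def)
    next
      case XQ: True
      \<comment> \<open>Conflicts with \<open>X \<in> Q\<close> rule out membership in
        \<open>Q\<close>, so only the weight comparison decides the predictions rule.\<close>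
      have nQ: "K \<notin> Q" if "K \<in> D" for K
        using that D(1,3) X(1) pairwiseD[OF Q(1) XQ, of K] by auto
      then have nprd: "\<forall>K\<in>D. \<not> prd K"
        using prd D(1) by blast
      have charge': "charge R' K = min (weight X) (weight K) + charge R K" if "K \<in> D" for K
        using that D(3) fin X XQ by (simp add: R'_def charge_insert)
      show ?thesis
      proof (cases "total_weight D \<le> weight X")
        case True
        have "potential h Q R K \<le> (2 + h) * weight K" if K: "K \<in> D" for K
        proof -
          have "weight K \<le> total_weight D"
            unfolding wD[symmetric] using K D w by (intro member_le_sum) (auto simp: less_imp_le)
          then have "charge R' K = weight K + charge R K"
            using charge'[OF K] True by simp
          \<comment> \<open>The bound is taken for \<open>R'\<close>, which contains
            \<open>X\<close>; removing the share of \<open>X\<close> leaves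
            \<open>2 * weight K\<close> for \<open>R\<close>.\<close>
          moreover have "charge R' K \<le> 3 * weight K"
            using K D proper by (intro charge_le finR' dR') (auto simp: R'_def split: if_splits)
          ultimately show ?thesis
            using nQ[OF K] by (simp add: potential_def algebra_simps)
        qed
        then have "sum (potential h Q R) D \<le> (\<Sum>K\<in>D. (2 + h) * weight K)"
          by (intro sum_mono)
        also have "\<dots> = (2 + h) * total_weight D"
          by (simp add: sum_distrib_left wD[symmetric])
        also have "\<dots> \<le> (2 + h) * weight X"
          using True h by simp
        finally have "sum (potential h Q R) D + d \<le> potential h Q R' X"
          using XQ by (simp add: potential_def d_def algebra_simps)
        then show ?thesis
          using accept True nmain nprd XQ prd by (simp add: revoke_step_def Let_def D_def)
      next
        case False
        \<comment> \<open>\<open>X\<close> is rejected: the new charges on \<open>D\<close> alone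
          pay for its weight.\<close>
        have "weight X = min (weight X) (sum weight D)"
          using False wD by simp
        also have "\<dots> \<le> (\<Sum>K\<in>D. min (weight X) (weight K))"
          using D w by (intro min_le_sum_min) (auto simp: less_imp_le)
        also have "\<dots> = (\<Sum>K\<in>D. potential h Q R' K - potential h Q R K)"
          using nQ charge' by (intro sum.cong) (auto simp: potential_def)
        also have "\<dots> \<le> (\<Sum>K\<in>S. potential h Q R' K - potential h Q R K)"
          using D fin mono by (intro sum_mono2) auto
        finally have "total_weight R' \<le> sum (potential h Q R') S"
          using inv TR' XQ by (simp add: d_def sum_subtractf)
        then show ?thesis
          using False nmain by (simp add: revoke_step_def Let_def D_def)
      qed
    qed
  qed
qed

section \<open>The whole run and the competitive ratio\<close>

lemma revoke_step_subset: "revoke_step l prd S X \<subseteq> insert X S"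
  by (auto simp: revoke_step_def Let_def)

lemma revoke_proportional_snoc:
  "revoke_proportional l prd (xs @ [x]) = revoke_step l prd (revoke_proportional l prd xs) x"
  by (simp add: revoke_proportional_def)

lemma revoke_proportional_subset: "revoke_proportional l prd xs \<subseteq> set xs"
proof (induction xs rule: rev_induct)
  case (snoc x xs)
  then show ?case
    using revoke_step_subset[of l prd "revoke_proportional l prd xs" x]
    by (auto simp: revoke_proportional_snoc)
qed (simp add: revoke_proportional_def)

lemma revoke_proportional_potential:
  fixes l :: real
  assumes "l > 1" "distinct xs" "\<forall>I\<in>set xs. fst I < snd I"
    and Q: "pairwise (\<lambda>I J. \<not> conflict I J) Q" "\<forall>I\<in>set xs. prd I \<longleftrightarrow> I \<in> Q"
  shows "total_weight (Q \<inter> set xs) \<le>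
    sum (potential (3 / (l - 1)) Q (Q \<inter> set xs)) (revoke_proportional l prd xs)"
  using assms(2,3) Q(2)
proof (induction xs rule: rev_induct)
  case Nil
  then show ?case
    by (simp add: revoke_proportional_def total_weight_def)
next
  case (snoc x xs)
  let ?S = "revoke_proportional l prd xs"
  \<comment> \<open>With distinctness, this keeps \<open>x\<close> out of the current
    solution.\<close>
  have sub: "?S \<subseteq> set xs"
    by (rule revoke_proportional_subset)
  have R': "Q \<inter> set (xs @ [x]) = (if x \<in> Q then insert x (Q \<inter> set xs) else Q \<inter> set xs)"
    by auto
  show ?case
    unfolding R' revoke_proportional_snoc
    using snoc sub Q(1) assms(1)
    by (intro revoke_step_potential) (auto intro: finite_subset[OF sub])
qed

lemma finite_total_weights: "finite S \<Longrightarrow> finite (total_weight ` {T. feasible S T})"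
  by (rule finite_imageI, rule finite_subset[of _ "Pow S"]) (auto simp: feasible_def)

lemma OPT_pos:
  assumes "is_instance xs"
  shows "0 < OPT (set xs)"
proof -
  obtain I where I: "I \<in> set xs" "fst I < snd I"
    using assms by (cases xs) (auto simp: is_instance_def)
  then have "total_weight {I} \<le> OPT (set xs)"
    unfolding OPT_def by (intro Max_ge finite_total_weights) (auto simp: feasible_def)
  then show ?thesis
    using I by (simp add: total_weight_def weight_def)
qed

theorem theorem4p10:
  fixes l :: real
  assumes "l > 1"
  shows "consistent (3 * l / (l - 1)) (revoke_proportional l)"
  unfolding consistent_def
proof (intro allI impI)
  fix prd xs
  assume inst: "is_instance xs" and "accurate (set xs) prd"
  then obtain Q where Q: "Q \<subseteq> set xs" "pairwise (\<lambda>I J. \<not> conflict I J) Q"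
      "total_weight Q = OPT (set xs)" "\<forall>I\<in>set xs. prd I \<longleftrightarrow> I \<in> Q"
    by (auto simp: accurate_def optimal_solution_def feasible_def)
  let ?h = "3 / (l - 1)" and ?S = "revoke_proportional l prd xs"
  have eq: "3 + ?h = 3 * l / (l - 1)"
    using assms by (simp add: field_simps)
  have proper: "\<forall>I\<in>set xs. fst I < snd I"
    using inst by (simp add: is_instance_def)
  have "OPT (set xs) \<le> sum (potential ?h Q Q) ?S"
    using revoke_proportional_potential[OF assms _ proper Q(2,4)] Q inst
    by (simp add: is_instance_def Int_absorb2)
  also have "\<dots> \<le> (\<Sum>K\<in>?S. (3 + ?h) * weight K)"
    using Q proper revoke_proportional_subset[of l prd xs] finite_subset[OF Q(1)]
    by (intro sum_mono potential_le) auto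
  also have "\<dots> = 3 * l / (l - 1) * ALG (revoke_proportional l) prd xs"
    by (simp only: eq ALG_def total_weight_def sum_distrib_left)
  finally have le: "OPT (set xs) \<le> 3 * l / (l - 1) * ALG (revoke_proportional l) prd xs" .
  \<comment> \<open>Positivity of \<open>ALG\<close> comes from the same inequality, as
    \<open>OPT\<close> is positive.\<close>
  then have "0 < 3 * l / (l - 1) * ALG (revoke_proportional l) prd xs"
    using OPT_pos[OF inst] by linarith
  moreover have "0 < 3 * l / (l - 1)"
    using assms by simp
  ultimately have "0 < ALG (revoke_proportional l) prd xs"
    using zero_less_mult_pos by blast
  then show "competitive_at (3 * l / (l - 1)) (revoke_proportional l) prd xs"
    using le unfolding competitive_at_def by (simp add: pos_divide_le_eq)
qed

end
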